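(* Let $N \ge 2$ and consider the simple exclusion process with rates $\rho_x = 1$ for all $x$ on the path graph with vertex set $\mathscr{V} = \{0, 1, \ldots, N-1\}$, whose edges are exactly the pairs $(x, x+1)$ with $0 \le x \le N-2$. Then, for all $0 < K \le N$, $$ p_K(x) = \frac{(2N - K - 1)K}{(K-1)K + 4(N-K)(N-1)} \quad \text{for } x = 0, N-1 $$ and $$ p_K(x) = \left(\frac{K}{N-2}\right) \frac{(K-2)(K-1) + 4(N-K)(N-2)}{(K-1)K + 4(N-K)(N-1)} \quad \text{for } 0 < x < N-1. $$
   Context: Let $\mathscr{G} = (\mathscr{V},\mathscr{E})$ be a finite connected graph on $N$ vertices; $\deg(x)$ is the degree of $x$. A configuration is a map $\eta : \mathscr{V} \to \{0,1\}$, where $\eta(x) = 1$ means that $x$ is occupied by a particle and $\eta(x) = 0$ that $x$ is empty. A configuration $\eta$ is identified with the subset $\{x \in \mathscr{V} : \eta(x) = 1\}$ of $\mathscr{V}$. For $x, y \in \mathscr{V}$, $\tau_{x,y}\eta$ is the configuration obtained from $\eta$ by exchanging the states at $x$ and $y$. The simple exclusion process with rates $(\rho_x)$ is the continuous-time Markov chain $(\eta_t)_{t\ge 0}$ on $\{0,1\}^{\mathscr{V}}$ that jumps from $\eta$ to $\xi \ne \eta$ at rate $q(\eta,\xi) = \rho_x/\deg(x)$ if $\xi = \tau_{x,y}\eta$ for some edge $(x,y) \in \mathscr{E}$ with $\eta(x) = 1$ (hence $\eta(y) = 0$), and at rate $q(\eta,\xi) = 0$ otherwise. In words, the particle at $x$,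 if there is one, chooses a neighbor of $x$ uniformly at random at rate $\rho_x$ and jumps there if and only if it is empty. For $0 < K \le N$ and $x \in \mathscr{V}$, $$ p_K(x) = \lim_{t \to \infty} P(x \in \eta_t \mid \operatorname{card}(\eta_0) = K); $$ these limits exist and depend on the initial configuration only through its number $K$ of particles. *)

theory Defs
  imports "HOL-Probability.Probability" "HOL-Combinatorics.Transposition"
begin

definition transition_function :: "'s set \<Rightarrow> (real \<Rightarrow> 's \<Rightarrow> 's \<Rightarrow> real) \<Rightarrow> bool" where
  "transition_function S P \<longleftrightarrow>
     (\<forall>t\<ge>0. \<forall>i\<in>S. (\<forall>j\<in>S. 0 \<le> P t i j) \<and> (\<Sum>j\<in>S. P t i j) = 1) \<and>
     (\<forall>i\<in>S. \<forall>j\<in>S. P 0 i j = (if i = j then 1 else 0)) \<and>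
     (\<forall>s\<ge>0. \<forall>t\<ge>0. \<forall>i\<in>S. \<forall>j\<in>S. P (s + t) i j = (\<Sum>k\<in>S. P s i k * P t k j))"

text \<open>
  Only the off-diagonal values of the rate function matter.  As the rows of P sum to 1 and the
  state spaces considered here are finite, the derivative of the diagonal entries at 0 is then
  determined.
\<close>

definition has_jump_rates :: "'s set \<Rightarrow> ('s \<Rightarrow> 's \<Rightarrow> real) \<Rightarrow> (real \<Rightarrow> 's \<Rightarrow> 's \<Rightarrow> real) \<Rightarrow> bool" where
  "has_jump_rates S q P \<longleftrightarrow>
     (\<forall>i\<in>S. \<forall>j\<in>S. i \<noteq> j \<longrightarrow> ((\<lambda>h. P h i j / h) \<longlongrightarrow> q i j) (at_right 0))"

text \<open>
  Time-homogeneous continuous-time Markov chains with finite state space S and jump rates q; time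
  ranges over the nonnegative reals and the initial distribution is arbitrary.  The Markov property
  is written in product form, to avoid conditioning on null events.
\<close>

definition markov_chain_with_rates ::
  "'w measure \<Rightarrow> 's set \<Rightarrow> ('s \<Rightarrow> 's \<Rightarrow> real) \<Rightarrow> (real \<Rightarrow> 'w \<Rightarrow> 's) \<Rightarrow> bool" where
  "markov_chain_with_rates M S q X \<longleftrightarrow>
     prob_space M \<and> finite S \<and>
     (\<forall>t\<ge>0. X t \<in> measurable M (count_space S)) \<and>
     (AE \<omega> in M. \<forall>t\<ge>0. \<forall>\<^sub>F s in at_right t. X s \<omega> = X t \<omega>) \<and>
     (\<exists>P. transition_function S P \<and> has_jump_rates S q P \<and>
        (\<forall>(n::nat) (t :: nat \<Rightarrow> real) (s :: nat \<Rightarrow> 's).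
           0 \<le> t 0 \<longrightarrow> (\<forall>i\<le>n. t i \<le> t (Suc i)) \<longrightarrow> (\<forall>i\<le>Suc n. s i \<in> S) \<longrightarrow>
           \<P>(\<omega> in M. \<forall>i\<le>Suc n. X (t i) \<omega> = s i) =
             \<P>(\<omega> in M. \<forall>i\<le>n. X (t i) \<omega> = s i) * P (t (Suc n) - t n) (s n) (s (Suc n))))"

text \<open>
  A simple graph is given by its vertex set and its set of edges, an edge being a two-element set
  of vertices.  A configuration is the set of its occupied vertices.
\<close>

definition deg :: "'v set set \<Rightarrow> 'v \<Rightarrow> nat" where
  "deg E x = card {y. {x, y} \<in> E}"

definition exchange :: "'v \<Rightarrow> 'v \<Rightarrow> 'v set \<Rightarrow> 'v set" where
  "exchange x y \<eta> = Transposition.transpose x y ` \<eta>"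

text \<open>
  The index set of the sum has at most one element, see the two lemmas below.
\<close>

definition exclusion_rate :: "'v set set \<Rightarrow> ('v \<Rightarrow> real) \<Rightarrow> 'v set \<Rightarrow> 'v set \<Rightarrow> real" where
  "exclusion_rate E \<rho> \<eta> \<xi> =
     (\<Sum>(x, y) \<in> {(x, y). {x, y} \<in> E \<and> x \<in> \<eta> \<and> y \<notin> \<eta> \<and> \<xi> = exchange x y \<eta>}. \<rho> x / real (deg E x))"

lemma exchange_eq:
  assumes "x \<in> \<eta>" "y \<notin> \<eta>"
  shows "exchange x y \<eta> = insert y (\<eta> - {x})"
proof -
  have "\<eta> = insert x (\<eta> - {x})"
    using assms by blast
  then have "exchange x y \<eta> = insert y (Transposition.transpose x y ` (\<eta> - {x}))"
    unfolding exchange_def by (metis image_insert transpose_apply_first)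
  moreover have "Transposition.transpose x y ` (\<eta> - {x}) = (\<lambda>z. z) ` (\<eta> - {x})"
    using assms by (intro image_cong refl transpose_apply_other) auto
  ultimately show ?thesis
    by simp
qed

lemma exclusion_rate_exchange:
  assumes "{x, y} \<in> E" "x \<in> \<eta>" "y \<notin> \<eta>"
  shows "exclusion_rate E \<rho> \<eta> (exchange x y \<eta>) = \<rho> x / real (deg E x)"
proof -
  have "x' = x \<and> y' = y"
    if "x' \<in> \<eta>" "y' \<notin> \<eta>" "exchange x y \<eta> = exchange x' y' \<eta>" for x' y'
  proof -
    have "insert y (\<eta> - {x}) = insert y' (\<eta> - {x'})"
      using that assms exchange_eq by metis
    then have "y \<in> insert y' (\<eta> - {x'})" "x \<notin> insert y' (\<eta> - {x'})"
      using assms by (metis insertI1, metis Diff_iff insert_iff singletonI)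
    then show ?thesis
      using assms by simp
  qed
  then have "{(x', y'). {x', y'} \<in> E \<and> x' \<in> \<eta> \<and> y' \<notin> \<eta> \<and> exchange x y \<eta> = exchange x' y' \<eta>} = {(x, y)}"
    using assms by blast
  then show ?thesis
    by (simp add: exclusion_rate_def)
qed

lemma exclusion_rate_eq_0:
  assumes "\<And>x y. {x, y} \<in> E \<Longrightarrow> x \<in> \<eta> \<Longrightarrow> y \<notin> \<eta> \<Longrightarrow> \<xi> \<noteq> exchange x y \<eta>"
  shows "exclusion_rate E \<rho> \<eta> \<xi> = 0"
proof -
  have "{(x, y). {x, y} \<in> E \<and> x \<in> \<eta> \<and> y \<notin> \<eta> \<and> \<xi> = exchange x y \<eta>} = {}"
    using assms by blast
  then show ?thesis
    by (simp only: exclusion_rate_def sum.empty)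
qed

definition simple_exclusion_process ::
  "'w measure \<Rightarrow> 'v set \<Rightarrow> 'v set set \<Rightarrow> ('v \<Rightarrow> real) \<Rightarrow> (real \<Rightarrow> 'w \<Rightarrow> 'v set) \<Rightarrow> bool" where
  "simple_exclusion_process M V E \<rho> \<eta> \<longleftrightarrow>
     markov_chain_with_rates M (Pow V) (exclusion_rate E \<rho>) \<eta>"

definition path_vertices :: "nat \<Rightarrow> nat set" where
  "path_vertices N = {..<N}"

definition path_edges :: "nat \<Rightarrow> nat set set" where
  "path_edges N = {{x, x + 1} | x. x + 1 < N}"

text \<open>
  The limit defining $p_K(x)$ exists and equals p.  It is taken along one process,
  whose initial distribution gives positive probability to having K particles.
\<close>

definition has_limit_occupation ::
  "'w measure \<Rightarrow> (real \<Rightarrow> 'w \<Rightarrow> 'v set) \<Rightarrow> nat \<Rightarrow> 'v \<Rightarrow> real \<Rightarrow> bool" where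
  "has_limit_occupation M \<eta> K x p \<longleftrightarrow>
     ((\<lambda>t. \<P>(\<omega> in M. x \<in> \<eta> t \<omega> \<bar> card (\<eta> 0 \<omega>) = K)) \<longlongrightarrow> p) at_top"

end

theory Submission
  imports Defs
begin

text \<open>
  The process is reversible. Exchanging a particle at \<open>x\<close> with a hole at \<open>y\<close> has rate
  \<open>1 / deg x\<close>, and the reverse exchange has rate \<open>1 / deg y\<close>, so giving a configuration the
  weight \<open>\<Prod>x\<in>\<eta>. deg x\<close> balances each pair of opposite jumps
  (\<open>exclusion_detailed_balance\<close>). Jumps preserve the number of particles, and on the path any two
  configurations with equally many particles communicate (\<open>path_exclusion_irreducible\<close>). Hence,
  started from \<open>K\<close> particles, the law of the process converges to the weight normalised on the
  configurations of size \<open>K\<close> (\<open>transition_tendsto_stationary\<close>), and \<open>p\<^sub>K(x)\<close> is the share of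
  the total weight that is carried by the configurations containing \<open>x\<close>.

  The jump rates are the derivatives of the semigroup at 0, and balance of the rates means that
  the \<open>l\<^sup>1\<close> error \<open>D h\<close> made by evolving the weight for a time \<open>h\<close> is \<open>o(h)\<close>. As \<open>D\<close> is
  subadditive, \<open>D t \<le> n * D (t / n)\<close>, which tends to 0, so the weight is stationary. Since it is
  positive exactly on the class of \<open>K\<close> particles, this class cannot be left. Within the class all
  transition probabilities are positive at positive times, and so the transition matrix at
  time 1 dominates a positive multiple of the stationary law and contracts the distance to it
  by a fixed factor.

  It remains to evaluate elementary symmetric polynomials of the degrees, which are 2 except for
  a 1 at each end of the path. Expanding in the two exceptional vertices leaves binomial
  coefficients, and all of them are rational multiples of a single one, so the quotients are
  rational functions of \<open>N\<close> and \<open>K\<close> (\<open>config_sum_ratio_light\<close> for the ends,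
  \<open>config_sum_ratio_heavy\<close> for the other vertices).
\<close>

section \<open>Convergence of finite Markov chains with a balanced weight\<close>

text \<open>
  Global balance makes the error of the weight after a short time \<open>h\<close> of smaller order than
  \<open>h\<close>. Stochastic matrices do not increase the \<open>l\<^sup>1\<close> norm, so the errors of \<open>n\<close> steps of
  length \<open>t / n\<close> at most add up, and their sum vanishes as \<open>n\<close> grows.
\<close>

lemma stationary_of_balance:
  fixes \<pi> :: "'s \<Rightarrow> real"
  assumes fin: "finite S" and tf: "transition_function S P" and rates: "has_jump_rates S q P"
    and balance: "\<And>k. k \<in> S \<Longrightarrow> (\<Sum>i\<in>S - {k}. \<pi> i * q i k) = \<pi> k * (\<Sum>i\<in>S - {k}. q k i)"
    and t: "0 \<le> t" and j: "j \<in> S"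
  shows "(\<Sum>i\<in>S. \<pi> i * P t i j) = \<pi> j"
proof (cases "t = 0")
  case True
  have "(\<Sum>i\<in>S. \<pi> i * P 0 i j) = (\<Sum>i\<in>S. if i = j then \<pi> i else 0)"
    using tf j by (intro sum.cong) (auto simp: transition_function_def)
  then show ?thesis
    using fin j True by simp
next
  case False
  then have t: "0 < t"
    using t by simp
  have nonneg: "0 \<le> P s i k" if "0 \<le> s" "i \<in> S" "k \<in> S" for s i k
    using tf that by (simp add: transition_function_def)
  have rows: "(\<Sum>k\<in>S. P s i k) = 1" if "0 \<le> s" "i \<in> S" for s i
    using tf that by (simp add: transition_function_def)
  have chapman: "P (s + u) i k = (\<Sum>l\<in>S. P s i l * P u l k)"
    if "0 \<le> s" "0 \<le> u" "i \<in> S" "k \<in> S" for s u i k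
    using tf that by (simp add: transition_function_def)
  define \<delta> where "\<delta> s k = (\<Sum>i\<in>S. \<pi> i * P s i k) - \<pi> k" for s k
  define D where "D s = (\<Sum>k\<in>S. \<bar>\<delta> s k\<bar>)" for s
  \<comment> \<open>The error row splits as \<open>\<pi> P\<^sub>s\<^sub>+\<^sub>u - \<pi> = (\<pi> P\<^sub>s - \<pi>) P\<^sub>u + (\<pi> P\<^sub>u - \<pi>)\<close>.\<close>
  have D_add: "D (s + u) \<le> D s + D u" if "0 \<le> s" "0 \<le> u" for s u
  proof -
    have "\<delta> (s + u) k = (\<Sum>l\<in>S. \<delta> s l * P u l k) + \<delta> u k" if k: "k \<in> S" for k
    proof -
      have "(\<Sum>i\<in>S. \<pi> i * P (s + u) i k) = (\<Sum>i\<in>S. \<Sum>l\<in>S. \<pi> i * P s i l * P u l k)"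
        using \<open>0 \<le> s\<close> \<open>0 \<le> u\<close> k by (intro sum.cong) (simp_all add: chapman sum_distrib_left mult.assoc)
      also have "\<dots> = (\<Sum>l\<in>S. (\<Sum>i\<in>S. \<pi> i * P s i l) * P u l k)"
        by (subst sum.swap) (simp add: sum_distrib_right)
      finally show ?thesis
        by (simp add: \<delta>_def left_diff_distrib sum_subtractf)
    qed
    then have "D (s + u) \<le> (\<Sum>k\<in>S. (\<Sum>l\<in>S. \<bar>\<delta> s l\<bar> * P u l k) + \<bar>\<delta> u k\<bar>)"
      unfolding D_def using nonneg \<open>0 \<le> u\<close>
      by (intro sum_mono)
         (auto intro!: order_trans[OF abs_triangle_ineq] order_trans[OF sum_abs] simp: abs_mult)
    also have "\<dots> = (\<Sum>l\<in>S. \<bar>\<delta> s l\<bar> * (\<Sum>k\<in>S. P u l k)) + D u"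
      by (simp add: sum.distrib D_def sum_distrib_left) (rule sum.swap)
    also have "\<dots> = D s + D u"
      using \<open>0 \<le> u\<close> by (simp add: rows D_def)
    finally show ?thesis .
  qed
  have D_mult: "D (real (Suc n) * h) \<le> real (Suc n) * D h" if "0 \<le> h" for n h
  proof (induction n)
    case (Suc n)
    have "D (real (Suc (Suc n)) * h) = D (real (Suc n) * h + h)"
      by (simp add: algebra_simps)
    also have "\<dots> \<le> D (real (Suc n) * h) + D h"
      using that by (intro D_add) auto
    finally show ?case
      using Suc by (simp add: algebra_simps)
  qed simp
  have "((\<lambda>h. \<delta> h k / h) \<longlongrightarrow> 0) (at_right 0)" if k: "k \<in> S" for k
  proof -
    have "((\<lambda>h. (\<Sum>i\<in>S - {k}. \<pi> i * (P h i k / h)) - \<pi> k * (\<Sum>i\<in>S - {k}. P h k i / h)) \<longlongrightarrow>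
        (\<Sum>i\<in>S - {k}. \<pi> i * q i k) - \<pi> k * (\<Sum>i\<in>S - {k}. q k i)) (at_right 0)"
      using rates k by (intro tendsto_intros) (auto simp: has_jump_rates_def)
    \<comment> \<open>The diagonal entry is eliminated through the row sum, so that only off-diagonal entries,
       whose derivatives are prescribed, remain.\<close>
    moreover have "\<delta> h k / h =
        (\<Sum>i\<in>S - {k}. \<pi> i * (P h i k / h)) - \<pi> k * (\<Sum>i\<in>S - {k}. P h k i / h)" if "0 < h" for h
    proof -
      have "1 - P h k k = (\<Sum>i\<in>S - {k}. P h k i)"
        using rows[of h k] that k fin by (simp add: sum.remove)
      moreover have "\<delta> h k = (\<Sum>i\<in>S - {k}. \<pi> i * P h i k) - \<pi> k * (1 - P h k k)"
        using k fin by (simp add: \<delta>_def sum.remove algebra_simps)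
      ultimately show ?thesis
        by (simp add: sum_divide_distrib[symmetric] diff_divide_distrib)
    qed
    then have "\<forall>\<^sub>F h in at_right 0. (\<Sum>i\<in>S - {k}. \<pi> i * (P h i k / h)) -
        \<pi> k * (\<Sum>i\<in>S - {k}. P h k i / h) = \<delta> h k / h"
      by (intro eventually_mono[OF eventually_at_right_less]) simp
    ultimately show ?thesis
      using balance[OF k] Lim_transform_eventually by fastforce
  qed
  then have "((\<lambda>h. \<Sum>k\<in>S. \<bar>\<delta> h k / h\<bar>) \<longlongrightarrow> (\<Sum>k\<in>S. \<bar>0\<bar>)) (at_right 0)"
    by (intro tendsto_sum tendsto_rabs)
  moreover have "filterlim (\<lambda>n. t / real (Suc n)) (at_right 0) sequentially"
  proof -
    have "(\<lambda>n. t * inverse (real (Suc n))) \<longlonglongrightarrow> t * 0"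
      by (intro tendsto_mult tendsto_const LIMSEQ_inverse_real_of_nat)
    then show ?thesis
      using t by (intro tendsto_imp_filterlim_at_right) (auto simp: divide_inverse)
  qed
  ultimately have "(\<lambda>n. \<Sum>k\<in>S. \<bar>\<delta> (t / real (Suc n)) k / (t / real (Suc n))\<bar>) \<longlonglongrightarrow> 0"
    using filterlim_compose by fastforce
  then have "(\<lambda>n. t * (\<Sum>k\<in>S. \<bar>\<delta> (t / real (Suc n)) k / (t / real (Suc n))\<bar>)) \<longlonglongrightarrow> t * 0"
    by (intro tendsto_mult tendsto_const)
  moreover have "D t \<le> t * (\<Sum>k\<in>S. \<bar>\<delta> (t / real (Suc n)) k / (t / real (Suc n))\<bar>)" for n
  proof -
    have "D t \<le> real (Suc n) * D (t / real (Suc n))"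
      using D_mult[of "t / real (Suc n)" n] t by simp
    also have "\<dots> = t * (D (t / real (Suc n)) / (t / real (Suc n)))"
      using t by simp
    also have "\<dots> = t * (\<Sum>k\<in>S. \<bar>\<delta> (t / real (Suc n)) k / (t / real (Suc n))\<bar>)"
      using t by (simp only: D_def sum_divide_distrib abs_divide abs_of_pos divide_pos_pos of_nat_0_less_iff zero_less_Suc)
    finally show ?thesis .
  qed
  ultimately have "D t \<le> 0"
    by (intro LIMSEQ_le_const[where X = "\<lambda>n. t * (\<Sum>k\<in>S. \<bar>\<delta> (t / real (Suc n)) k / (t / real (Suc n))\<bar>)"])
       auto
  moreover have "\<bar>\<delta> t j\<bar> \<le> D t"
    unfolding D_def using j fin by (intro member_le_sum) auto
  ultimately show ?thesis
    by (simp add: \<delta>_def)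
qed

text \<open>
  The single path through \<open>j\<close> bounds the Chapman--Kolmogorov sum from below.
\<close>

lemma transition_mult_le:
  assumes "finite S" "transition_function S P" "0 \<le> s" "0 \<le> t" "i \<in> S" "j \<in> S" "k \<in> S"
  shows "P s i j * P t j k \<le> P (s + t) i k"
proof -
  have "P s i j * P t j k \<le> (\<Sum>l\<in>S. P s i l * P t l k)"
    using assms by (intro member_le_sum) (auto simp: transition_function_def)
  then show ?thesis
    using assms by (simp add: transition_function_def)
qed

text \<open>
  For short times this is continuity at 0, which follows from the jump rates being finite. A long
  time is cut into short pieces, and the chain may stay at \<open>i\<close> at the end of every piece.
\<close>

lemma transition_diagonal_pos:
  assumes fin: "finite S" and tf: "transition_function S P" and rates: "has_jump_rates S q P"
    and t: "0 \<le> t" and i: "i \<in> S"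
  shows "0 < P t i i"
proof -
  have "((\<lambda>h. 1 - (\<Sum>j\<in>S - {i}. h * (P h i j / h))) \<longlongrightarrow> 1 - (\<Sum>j\<in>S - {i}. 0 * q i j)) (at_right 0)"
    using rates i by (intro tendsto_intros) (auto simp: has_jump_rates_def)
  then have "((\<lambda>h. 1 - (\<Sum>j\<in>S - {i}. h * (P h i j / h))) \<longlongrightarrow> 1) (at_right 0)"
    by simp
  then have "\<forall>\<^sub>F h in at_right 0. 0 < 1 - (\<Sum>j\<in>S - {i}. h * (P h i j / h))"
    by (rule order_tendstoD) simp
  then obtain b where b: "0 < b" "\<And>h. 0 < h \<Longrightarrow> h < b \<Longrightarrow> 0 < 1 - (\<Sum>j\<in>S - {i}. h * (P h i j / h))"
    by (auto simp: eventually_at_right_field)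
  have small: "0 < P h i i" if "0 \<le> h" "h < b" for h
  proof (cases "h = 0")
    case True
    then show ?thesis
      using tf i by (simp add: transition_function_def)
  next
    case False
    moreover have "(\<Sum>j\<in>S. P h i j) = P h i i + (\<Sum>j\<in>S - {i}. P h i j)"
      using fin i by (rule sum.remove)
    moreover have "(\<Sum>j\<in>S. P h i j) = 1"
      using tf that i by (simp add: transition_function_def)
    ultimately show ?thesis
      using b(2)[of h] that by simp
  qed
  obtain n where n: "t / b < real (Suc n)"
    using reals_Archimedean2 less_trans of_nat_less_iff lessI by metis
  define h where "h = t / real (Suc n)"
  have h: "0 \<le> h" "h < b"
    using n t b(1) by (auto simp: h_def field_simps)
  have "0 < P (real m * h) i i" for m
  proof (induction m)
    case 0
    then show ?case
      using small[of 0] b by simp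
  next
    case (Suc m)
    have "0 < P (real m * h) i i * P h i i"
      using Suc small h by simp
    also have "\<dots> \<le> P (real m * h + h) i i"
      using fin tf h i by (intro transition_mult_le) auto
    finally show ?case
      by (simp add: algebra_simps)
  qed
  from this[of "Suc n"] show ?thesis
    by (simp add: h_def)
qed

text \<open>
  A single jump happens with positive probability at arbitrarily short times, and waiting
  beforehand extends this to every positive time. Having positivity at all times, not just at
  some time depending on the path, is what makes the induction along a path, which halves the
  time, go through.
\<close>

lemma transition_pos_of_reachable:
  assumes fin: "finite S" and tf: "transition_function S P" and rates: "has_jump_rates S q P"
    and reach: "(i, j) \<in> {(a, b). a \<in> S \<and> b \<in> S \<and> 0 < q a b}\<^sup>*" and i: "i \<in> S" and t: "0 < t"
  shows "0 < P t i j"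
proof -
  have one_step: "0 < P s a b" if ab: "a \<in> S" "b \<in> S" "0 < q a b" and s: "0 < s" for s a b
  proof (cases "a = b")
    case True
    then show ?thesis
      using transition_diagonal_pos[OF fin tf rates] s ab by simp
  next
    case False
    then have "((\<lambda>h. P h a b / h) \<longlongrightarrow> q a b) (at_right 0)"
      using rates ab by (simp add: has_jump_rates_def)
    then have "\<forall>\<^sub>F h in at_right 0. 0 < P h a b / h"
      using ab(3) by (rule order_tendstoD)
    moreover have "\<forall>\<^sub>F h in at_right 0. 0 < h \<and> h < s"
      using s by (auto simp: eventually_at_right_field)
    ultimately have "\<forall>\<^sub>F h in at_right 0. 0 < P h a b / h \<and> 0 < h \<and> h < s"
      by (rule eventually_conj)
    then obtain h where h: "0 < P h a b / h" "0 < h" "h < s"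
      using eventually_happens[of _ "at_right (0::real)"] by auto
    have "0 < P (s - h) a a * P h a b"
      using transition_diagonal_pos[OF fin tf rates, of "s - h" a] h ab
      by (simp add: zero_less_divide_iff)
    also have "\<dots> \<le> P (s - h + h) a b"
      using fin tf ab h by (intro transition_mult_le) auto
    finally show ?thesis
      by simp
  qed
  have "j \<in> S \<and> (\<forall>t>0. 0 < P t i j)"
    using reach
  proof induction
    case base
    then show ?case
      using i transition_diagonal_pos[OF fin tf rates] by simp
  next
    case (step j k)
    have "0 < P t i k" if "0 < t" for t
    proof -
      have "0 < P (t / 2) i j * P (t / 2) j k"
        using step one_step[of j k] \<open>0 < t\<close> by simp
      also have "\<dots> \<le> P (t / 2 + t / 2) i k"
        using fin tf step i \<open>0 < t\<close> by (intro transition_mult_le) auto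
      finally show ?thesis
        by simp
    qed
    then show ?case
      using step by simp
  qed
  then show ?thesis
    using t by simp
qed

text \<open>
  Doeblin's argument: on the class \<open>C\<close> the entries of the transition matrix at time 1 are bounded
  below by some \<open>\<epsilon> > 0\<close>, hence by \<open>\<epsilon>\<close> times the normalised weight. Removing that part does not
  affect functions of mean 0 and leaves a nonnegative matrix with row sums \<open>1 - \<epsilon>\<close>, so the
  deviation from the limit shrinks by the factor \<open>1 - \<epsilon>\<close> in each unit of time.
\<close>

theorem transition_tendsto_stationary:
  fixes \<pi> :: "'s \<Rightarrow> real"
  assumes fin: "finite S" and tf: "transition_function S P" and rates: "has_jump_rates S q P"
    and C: "C \<subseteq> S"
    and \<pi>_pos: "\<And>k. k \<in> C \<Longrightarrow> 0 < \<pi> k" and \<pi>_0: "\<And>k. k \<in> S - C \<Longrightarrow> \<pi> k = 0"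
    and balance: "\<And>k. k \<in> S \<Longrightarrow> (\<Sum>i\<in>S - {k}. \<pi> i * q i k) = \<pi> k * (\<Sum>i\<in>S - {k}. q k i)"
    and irred: "\<And>i j. i \<in> C \<Longrightarrow> j \<in> C \<Longrightarrow> (i, j) \<in> {(a, b). a \<in> S \<and> b \<in> S \<and> 0 < q a b}\<^sup>*"
    and i: "i \<in> C" and j: "j \<in> S"
  shows "((\<lambda>t. P t i j) \<longlongrightarrow> \<pi> j / (\<Sum>k\<in>C. \<pi> k)) at_top"
proof -
  have finC: "finite C"
    using fin C finite_subset by blast
  define Z where "Z = (\<Sum>k\<in>C. \<pi> k)"
  have Z: "0 < Z"
    unfolding Z_def using finC i \<pi>_pos by (intro sum_pos) auto
  have nonneg: "0 \<le> P t a b" if "0 \<le> t" "a \<in> S" "b \<in> S" for t a b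
    using tf that by (simp add: transition_function_def)
  have stat: "(\<Sum>a\<in>C. \<pi> a * P t a b) = \<pi> b" if "0 \<le> t" "b \<in> S" for t b
  proof -
    have "(\<Sum>a\<in>S. \<pi> a * P t a b) = \<pi> b"
      using stationary_of_balance[OF fin tf rates balance that] .
    moreover have "(\<Sum>a\<in>S. \<pi> a * P t a b) = (\<Sum>a\<in>C. \<pi> a * P t a b)"
      using fin C \<pi>_0 by (intro sum.mono_neutral_right) auto
    ultimately show ?thesis
      by simp
  qed
  \<comment> \<open>Mass leaking out of \<open>C\<close> would show up as stationary weight outside \<open>C\<close>.\<close>
  have closed: "P t a b = 0" if "0 \<le> t" "a \<in> C" "b \<in> S - C" for t a b
  proof -
    have "(\<Sum>a\<in>C. \<pi> a * P t a b) = 0"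
      using stat[of t b] \<pi>_0 that by simp
    moreover have "0 \<le> \<pi> a * P t a b" if "a \<in> C" for a
      using \<pi>_pos[OF that] nonneg[of t a b] \<open>0 \<le> t\<close> \<open>b \<in> S - C\<close> C that by auto
    ultimately have "\<pi> a * P t a b = 0"
      using finC \<open>a \<in> C\<close> by (simp add: sum_nonneg_eq_0_iff)
    then show ?thesis
      using \<pi>_pos[OF \<open>a \<in> C\<close>] by simp
  qed
  have rows: "(\<Sum>b\<in>C. P t a b) = 1" if "0 \<le> t" "a \<in> C" for t a
  proof -
    have "(\<Sum>b\<in>S. P t a b) = (\<Sum>b\<in>C. P t a b)"
      using fin C closed[OF that] by (intro sum.mono_neutral_right) auto
    then show ?thesis
      using tf that C by (auto simp: transition_function_def)
  qed
  define \<epsilon> where "\<epsilon> = Min ((\<lambda>(a, b). P 1 a b) ` (C \<times> C))"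
  have \<epsilon>_le: "\<epsilon> \<le> P 1 a b" if "a \<in> C" "b \<in> C" for a b
    unfolding \<epsilon>_def using that finC by (intro Min_le) (auto intro!: image_eqI[of _ _ "(a, b)"])
  have \<epsilon>_pos: "0 < \<epsilon>"
    unfolding \<epsilon>_def using finC i transition_pos_of_reachable[OF fin tf rates irred] C
    by (subst Min_gr_iff) auto
  have minorised: "\<epsilon> * (\<pi> b / Z) \<le> P 1 a b" if "a \<in> C" "b \<in> C" for a b
  proof -
    have "\<pi> b \<le> Z"
      unfolding Z_def using finC that \<pi>_pos by (intro member_le_sum) (auto simp: less_imp_le)
    then have "\<epsilon> * (\<pi> b / Z) \<le> \<epsilon> * 1"
      using Z \<epsilon>_pos by (intro mult_left_mono) auto
    then show ?thesis
      using \<epsilon>_le[OF that] by simp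
  qed
  have mass: "(\<Sum>b\<in>C. \<pi> b / Z) = 1"
    using Z by (simp add: Z_def sum_divide_distrib[symmetric])
  have \<epsilon>_le_1: "\<epsilon> \<le> 1"
  proof -
    have "\<epsilon> = (\<Sum>b\<in>C. \<epsilon> * (\<pi> b / Z))"
      by (simp only: mass mult_1_right flip: sum_distrib_left)
    also have "\<dots> \<le> (\<Sum>b\<in>C. P 1 i b)"
      using minorised[OF i] by (intro sum_mono)
    finally show ?thesis
      using rows[of 1 i] i by simp
  qed
  define f where "f t a = P t a j - \<pi> j / Z" for t a
  have f_mean: "(\<Sum>a\<in>C. \<pi> a * f t a) = 0" if "0 \<le> t" for t
  proof -
    have "(\<Sum>a\<in>C. \<pi> a * f t a) = (\<Sum>a\<in>C. \<pi> a * P t a j) - Z * (\<pi> j / Z)"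
      by (simp only: f_def right_diff_distrib sum_subtractf sum_distrib_right Z_def)
    then show ?thesis
      using stat[OF that j] Z by simp
  qed
  have f_step: "f (t + 1) a = (\<Sum>b\<in>C. (P 1 a b - \<epsilon> * (\<pi> b / Z)) * f t b)"
    if "0 \<le> t" "a \<in> C" for t a
  proof -
    have "P (1 + t) a j = (\<Sum>b\<in>S. P 1 a b * P t b j)"
      using tf that C j by (auto simp: transition_function_def)
    also have "\<dots> = (\<Sum>b\<in>C. P 1 a b * P t b j)"
      using fin C closed[of 1 a] that by (intro sum.mono_neutral_right) auto
    finally have "P (1 + t) a j = (\<Sum>b\<in>C. P 1 a b * P t b j)" .
    moreover have "(\<Sum>b\<in>C. P 1 a b * (\<pi> j / Z)) = \<pi> j / Z"
      using rows[of 1 a] that by (simp only: zero_le_one mult_1_left flip: sum_distrib_right)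
    ultimately have "f (t + 1) a = (\<Sum>b\<in>C. P 1 a b * f t b)"
      by (simp only: f_def right_diff_distrib sum_subtractf add.commute)
    moreover have "(\<Sum>b\<in>C. \<epsilon> * (\<pi> b / Z) * f t b) = (\<epsilon> / Z) * (\<Sum>b\<in>C. \<pi> b * f t b)"
      by (simp add: sum_distrib_left mult.assoc)
    ultimately show ?thesis
      using f_mean[OF that(1)] by (simp only: left_diff_distrib sum_subtractf mult_zero_right diff_0_right)
  qed
  have contraction: "\<bar>f t a\<bar> \<le> (1 - \<epsilon>) ^ n" if "real n \<le> t" "a \<in> C" for n t a
    using that
  proof (induction n arbitrary: t a)
    case 0
    then have t: "0 \<le> t" and a: "a \<in> S"
      using C by auto
    have "0 \<le> P t a j"
      using nonneg t a j .
    moreover have "P t a j \<le> (\<Sum>b\<in>S. P t a b)"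
      using fin nonneg[OF t a] by (intro member_le_sum j) simp_all
    moreover have "(\<Sum>b\<in>S. P t a b) = 1"
      using t a tf by (simp add: transition_function_def)
    moreover have "0 \<le> \<pi> j / Z \<and> \<pi> j / Z \<le> 1"
    proof (cases "j \<in> C")
      case True
      then have "\<pi> j \<le> Z"
        unfolding Z_def using finC \<pi>_pos by (intro member_le_sum) (auto simp: less_imp_le)
      then show ?thesis
        using Z \<pi>_pos[OF True] by simp
    qed (use \<pi>_0 j in simp)
    ultimately show ?case
      unfolding f_def power_0 abs_le_iff by linarith
  next
    case (Suc n)
    have "\<bar>f t a\<bar> = \<bar>\<Sum>b\<in>C. (P 1 a b - \<epsilon> * (\<pi> b / Z)) * f (t - 1) b\<bar>"
      using f_step[of "t - 1" a] Suc.prems by simp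
    also have "\<dots> \<le> (\<Sum>b\<in>C. \<bar>(P 1 a b - \<epsilon> * (\<pi> b / Z)) * f (t - 1) b\<bar>)"
      by (rule sum_abs)
    also have "\<dots> \<le> (\<Sum>b\<in>C. (P 1 a b - \<epsilon> * (\<pi> b / Z)) * (1 - \<epsilon>) ^ n)"
      using Suc minorised
      by (intro sum_mono) (auto simp: abs_mult intro!: mult_mono)
    also have "\<dots> = ((\<Sum>b\<in>C. P 1 a b) - \<epsilon> * (\<Sum>b\<in>C. \<pi> b / Z)) * (1 - \<epsilon>) ^ n"
      by (simp only: sum_subtractf sum_distrib_left flip: sum_distrib_right)
    also have "\<dots> = (1 - \<epsilon>) * (1 - \<epsilon>) ^ n"
      using rows[of 1 a] mass Suc.prems by simp
    finally show ?case
      by simp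
  qed
  have "((\<lambda>t. f t i) \<longlongrightarrow> 0) at_top"
  proof (rule tendsto_rabs_zero_cancel, rule tendstoI)
    fix e :: real
    assume "0 < e"
    then obtain n where n: "(1 - \<epsilon>) ^ n < e"
      using real_arch_pow_inv[of e "1 - \<epsilon>"] \<epsilon>_pos by auto
    have "dist \<bar>f t i\<bar> 0 < e" if "real n \<le> t" for t
      using contraction[OF that i] n by simp
    then show "\<forall>\<^sub>F t in at_top. dist \<bar>f t i\<bar> 0 < e"
      by (auto simp: eventually_at_top_linorder)
  qed
  then have "((\<lambda>t. f t i + \<pi> j / Z) \<longlongrightarrow> 0 + \<pi> j / Z) at_top"
    by (intro tendsto_intros)
  then show ?thesis
    by (simp add: f_def Z_def)
qed

text \<open>
  Since the limit of the transition probabilities is the same for all starting points in \<open>C\<close>,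
  averaging it over the conditional initial law does not change it.
\<close>

lemma markov_chain_conditional_limit:
  assumes chain: "markov_chain_with_rates M S q X" and C: "C \<subseteq> S"
    and pos: "0 < \<P>(\<omega> in M. X 0 \<omega> \<in> C)"
    and lim: "\<And>P i j. transition_function S P \<Longrightarrow> has_jump_rates S q P \<Longrightarrow> i \<in> C \<Longrightarrow> j \<in> S \<Longrightarrow>
      ((\<lambda>t. P t i j) \<longlongrightarrow> g j) at_top"
  shows "((\<lambda>t. \<P>(\<omega> in M. X t \<omega> \<in> A \<bar> X 0 \<omega> \<in> C)) \<longlongrightarrow> (\<Sum>j\<in>A \<inter> S. g j)) at_top"
proof -
  have "prob_space M" and fin: "finite S" and meas: "\<And>t. 0 \<le> t \<Longrightarrow> X t \<in> measurable M (count_space S)"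
    using chain unfolding markov_chain_with_rates_def by blast+
  interpret prob_space M
    by fact
  obtain P where tf: "transition_function S P" and rates: "has_jump_rates S q P"
    and fidi: "\<forall>(n::nat) (t :: nat \<Rightarrow> real) (s :: nat \<Rightarrow> _).
      0 \<le> t 0 \<longrightarrow> (\<forall>i\<le>n. t i \<le> t (Suc i)) \<longrightarrow> (\<forall>i\<le>Suc n. s i \<in> S) \<longrightarrow>
      \<P>(\<omega> in M. \<forall>i\<le>Suc n. X (t i) \<omega> = s i) =
        \<P>(\<omega> in M. \<forall>i\<le>n. X (t i) \<omega> = s i) * P (t (Suc n) - t n) (s n) (s (Suc n))"
    using chain unfolding markov_chain_with_rates_def by (elim conjE exE) (rule that)
  have finC: "finite C"
    using C fin finite_subset by blast
  have event: "{\<omega> \<in> space M. X t \<omega> = s} \<in> events" if "0 \<le> t" "s \<in> S" for t s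
    using measurable_sets[OF meas[OF that(1)], of "{s}"] that(2)
    by (simp add: vimage_def Int_def conj_commute)
  \<comment> \<open>The Markov property for the two times 0 and \<open>t\<close>.\<close>
  have joint: "\<P>(\<omega> in M. X 0 \<omega> = i \<and> X t \<omega> = j) = \<P>(\<omega> in M. X 0 \<omega> = i) * P t i j"
    if "0 \<le> t" "i \<in> S" "j \<in> S" for t i j
    using fidi[rule_format, of "\<lambda>k. if k = 0 then 0 else t" 0 "\<lambda>k. if k = 0 then i else j"] that
    by (simp add: le_Suc_eq all_conj_distrib conj_commute)
  have start: "\<P>(\<omega> in M. X 0 \<omega> \<in> C) = (\<Sum>i\<in>C. \<P>(\<omega> in M. X 0 \<omega> = i))"
  proof -
    have "{\<omega> \<in> space M. X 0 \<omega> \<in> C} = (\<Union>i\<in>C. {\<omega> \<in> space M. X 0 \<omega> = i})"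
      by auto
    then show ?thesis
      using finC C event[of 0]
      by (simp only:) (intro finite_measure_finite_Union, auto simp: disjoint_family_on_def)
  qed
  have later: "\<P>(\<omega> in M. X t \<omega> \<in> A \<and> X 0 \<omega> \<in> C) =
      (\<Sum>i\<in>C. \<Sum>j\<in>A \<inter> S. \<P>(\<omega> in M. X 0 \<omega> = i) * P t i j)" if t: "0 \<le> t" for t
  proof -
    have "{\<omega> \<in> space M. X t \<omega> \<in> A \<and> X 0 \<omega> \<in> C} =
        (\<Union>p\<in>C \<times> (A \<inter> S). {\<omega> \<in> space M. X 0 \<omega> = fst p \<and> X t \<omega> = snd p})"
      using measurable_space[OF meas[OF t]] by auto
    moreover have "{\<omega> \<in> space M. X 0 \<omega> = fst p \<and> X t \<omega> = snd p} \<in> events"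
      if "p \<in> C \<times> (A \<inter> S)" for p
    proof -
      have "{\<omega> \<in> space M. X 0 \<omega> = fst p} \<inter> {\<omega> \<in> space M. X t \<omega> = snd p} \<in> events"
        using that C t by (intro sets.Int event) auto
      moreover have "{\<omega> \<in> space M. X 0 \<omega> = fst p \<and> X t \<omega> = snd p} =
          {\<omega> \<in> space M. X 0 \<omega> = fst p} \<inter> {\<omega> \<in> space M. X t \<omega> = snd p}"
        by auto
      ultimately show ?thesis
        by simp
    qed
    ultimately have "\<P>(\<omega> in M. X t \<omega> \<in> A \<and> X 0 \<omega> \<in> C) =
        (\<Sum>p\<in>C \<times> (A \<inter> S). \<P>(\<omega> in M. X 0 \<omega> = fst p \<and> X t \<omega> = snd p))"
      using finC fin
      by (simp only:) (intro finite_measure_finite_Union, auto simp: disjoint_family_on_def)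
    also have "\<dots> = (\<Sum>p\<in>C \<times> (A \<inter> S). \<P>(\<omega> in M. X 0 \<omega> = fst p) * P t (fst p) (snd p))"
      using t C by (intro sum.cong refl joint) auto
    also have "\<dots> = (\<Sum>i\<in>C. \<Sum>j\<in>A \<inter> S. \<P>(\<omega> in M. X 0 \<omega> = i) * P t i j)"
      by (simp add: sum.cartesian_product case_prod_beta)
    finally show ?thesis .
  qed
  have limit: "((\<lambda>t. (\<Sum>i\<in>C. \<Sum>j\<in>A \<inter> S. \<P>(\<omega> in M. X 0 \<omega> = i) * P t i j) / \<P>(\<omega> in M. X 0 \<omega> \<in> C)) \<longlongrightarrow>
      (\<Sum>i\<in>C. \<Sum>j\<in>A \<inter> S. \<P>(\<omega> in M. X 0 \<omega> = i) * g j) / \<P>(\<omega> in M. X 0 \<omega> \<in> C)) at_top"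
    using lim[OF tf rates] pos by (intro tendsto_intros) auto
  have average: "(\<Sum>i\<in>C. \<Sum>j\<in>A \<inter> S. \<P>(\<omega> in M. X 0 \<omega> = i) * g j) / \<P>(\<omega> in M. X 0 \<omega> \<in> C) =
      (\<Sum>j\<in>A \<inter> S. g j)"
    using pos start by (simp flip: sum_distrib_left sum_distrib_right)
  have later_cond: "\<forall>\<^sub>F t in at_top. (\<Sum>i\<in>C. \<Sum>j\<in>A \<inter> S. \<P>(\<omega> in M. X 0 \<omega> = i) * P t i j) /
      \<P>(\<omega> in M. X 0 \<omega> \<in> C) = \<P>(\<omega> in M. X t \<omega> \<in> A \<bar> X 0 \<omega> \<in> C)"
    using eventually_ge_at_top[of 0] by eventually_elim (simp only: cond_prob_def later)
  show ?thesis
    using Lim_transform_eventually[OF limit later_cond] unfolding average .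
qed

section \<open>Reversibility of the exclusion process\<close>

definition deg_weight :: "'v set set \<Rightarrow> 'v set \<Rightarrow> real" where
  "deg_weight E \<eta> = (\<Prod>x\<in>\<eta>. real (deg E x))"

text \<open>
  Along a jump from \<open>x\<close> to \<open>y\<close> the weights of the two configurations differ only by having the
  factor \<open>deg x\<close> or \<open>deg y\<close>, which the rate \<open>1 / deg x\<close> or \<open>1 / deg y\<close> cancels; the
  reverse of a jump is a jump, so otherwise both rates are 0.
\<close>

lemma exclusion_detailed_balance:
  assumes fin: "finite (\<Union>E)" and \<eta>: "finite \<eta>" and \<xi>: "finite \<xi>"
  shows "deg_weight E \<eta> * exclusion_rate E (\<lambda>_. 1) \<eta> \<xi> = deg_weight E \<xi> * exclusion_rate E (\<lambda>_. 1) \<xi> \<eta>"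
proof -
  have deg: "0 < deg E x" if "{x, y} \<in> E" for x y
  proof -
    have "finite {y. {x, y} \<in> E}"
      using fin by (rule rev_finite_subset) auto
    then show ?thesis
      using that by (auto simp: deg_def card_gt_0_iff)
  qed
  have move: "deg_weight E \<eta> * exclusion_rate E (\<lambda>_. 1) \<eta> \<xi> = deg_weight E \<xi> * exclusion_rate E (\<lambda>_. 1) \<xi> \<eta>"
    if xy: "{x, y} \<in> E" "x \<in> \<eta>" "y \<notin> \<eta>" "\<xi> = exchange x y \<eta>" and fin_\<eta>: "finite \<eta>"
    for \<eta> \<xi> :: "'a set" and x y
  proof -
    have \<xi>: "\<xi> = insert y (\<eta> - {x})"
      using xy exchange_eq by metis
    have yx: "{y, x} \<in> E" "y \<in> \<xi>" "x \<notin> \<xi>"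
      using xy(1-3) \<xi> by (auto simp: insert_commute)
    have "\<eta> = exchange y x \<xi>"
      using yx xy(2,3) \<xi> exchange_eq[of y \<xi> x] by auto
    then have "exclusion_rate E (\<lambda>_. 1) \<xi> \<eta> = 1 / real (deg E y)"
      using exclusion_rate_exchange[OF yx, of "\<lambda>_. 1"] by simp
    moreover have "exclusion_rate E (\<lambda>_. 1) \<eta> \<xi> = 1 / real (deg E x)"
      using exclusion_rate_exchange[OF xy(1-3), of "\<lambda>_. 1"] xy(4) by simp
    moreover have "deg_weight E \<eta> = real (deg E x) * deg_weight E (\<eta> - {x})"
      unfolding deg_weight_def using fin_\<eta> xy(2) by (rule prod.remove)
    moreover have "deg_weight E \<xi> = real (deg E y) * deg_weight E (\<eta> - {x})"
      unfolding deg_weight_def \<xi> using fin_\<eta> xy by (subst prod.insert) auto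
    ultimately show ?thesis
      using deg[OF xy(1)] deg[OF yx(1)] by simp
  qed
  show ?thesis
  proof (cases "\<exists>x y. {x, y} \<in> E \<and> x \<in> \<eta> \<and> y \<notin> \<eta> \<and> \<xi> = exchange x y \<eta>")
    case True
    then show ?thesis
      using move \<eta> by blast
  next
    case no_move: False
    show ?thesis
    proof (cases "\<exists>x y. {x, y} \<in> E \<and> x \<in> \<xi> \<and> y \<notin> \<xi> \<and> \<eta> = exchange x y \<xi>")
      case True
      then show ?thesis
        using move[of _ _ \<xi> \<eta>] \<xi> by metis
    next
      case False
      have "exclusion_rate E (\<lambda>_. 1) \<eta> \<xi> = 0" "exclusion_rate E (\<lambda>_. 1) \<xi> \<eta> = 0"
        using no_move False by (auto intro!: exclusion_rate_eq_0)
      then show ?thesis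
        by simp
    qed
  qed
qed

lemma card_exchange: "card (exchange x y \<eta>) = card \<eta>"
  unfolding exchange_def by (intro card_image inj_on_subset[OF inj_transpose]) simp

lemma exclusion_rate_card_neq:
  assumes "card \<eta> \<noteq> card \<xi>"
  shows "exclusion_rate E \<rho> \<eta> \<xi> = 0"
  using assms by (intro exclusion_rate_eq_0) (auto simp: card_exchange)

section \<open>The exclusion process on the path\<close>

lemma path_edge_iff: "{x, y} \<in> path_edges N \<longleftrightarrow> (y = Suc x \<or> x = Suc y) \<and> x < N \<and> y < N"
  by (auto simp: path_edges_def doubleton_eq_iff)

lemma deg_path:
  assumes "2 \<le> N" "x < N"
  shows "deg (path_edges N) x = (if x = 0 \<or> x = N - 1 then 1 else 2)"
proof -
  have "{y. {x, y} \<in> path_edges N} =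
      (if x = 0 then {1} else if x = N - 1 then {x - 1} else {x - 1, x + 1})"
    using assms by (auto simp: path_edge_iff)
  then show ?thesis
    by (simp add: deg_def)
qed

text \<open>
  Every configuration can be packed against the left end: while some particle has a hole directly
  on its left, moving it there lowers the sum of the occupied positions. Each such move can be
  undone, so any two configurations of the same size are connected through the packed one.
\<close>

lemma path_exclusion_irreducible:
  assumes N: "2 \<le> N" and \<eta>: "\<eta> \<subseteq> {..<N}" "card \<eta> = K" and \<xi>: "\<xi> \<subseteq> {..<N}" "card \<xi> = K"
  shows "(\<eta>, \<xi>) \<in> {(a, b). a \<in> Pow {..<N} \<and> b \<in> Pow {..<N} \<and>
    0 < exclusion_rate (path_edges N) (\<lambda>_. 1) a b}\<^sup>*" (is "_ \<in> ?R\<^sup>*")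
proof -
  have jump: "(\<zeta>, exchange x y \<zeta>) \<in> ?R"
    if "{x, y} \<in> path_edges N" "x \<in> \<zeta>" "y \<notin> \<zeta>" "\<zeta> \<subseteq> {..<N}" for x y \<zeta>
  proof -
    have "exchange x y \<zeta> = insert y (\<zeta> - {x})"
      using that exchange_eq by metis
    then show ?thesis
      using that exclusion_rate_exchange[OF that(1-3), of "\<lambda>_. 1"] deg_path[OF N, of x]
      by (auto simp: path_edge_iff)
  qed
  have packed: "(\<zeta>, {..<K}) \<in> ?R\<^sup>* \<and> ({..<K}, \<zeta>) \<in> ?R\<^sup>*" if "\<zeta> \<subseteq> {..<N}" "card \<zeta> = K" for \<zeta>
    using that
  proof (induction "\<Sum>\<zeta>" arbitrary: \<zeta> rule: less_induct)
    case less
    have fin: "finite \<zeta>"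
      using less.prems finite_subset by blast
    show ?case
    proof (cases "\<exists>y. y \<notin> \<zeta> \<and> Suc y \<in> \<zeta>")
      case False
      \<comment> \<open>No particle can move left, so the configuration is an initial segment.\<close>
      have down: "y \<in> \<zeta>" if "x \<in> \<zeta>" "y \<le> x" for x y
        using that(2,1) False by (induction rule: inc_induct) auto
      have "\<zeta> \<subseteq> {..<K}"
      proof
        fix x assume "x \<in> \<zeta>"
        then have "{..x} \<subseteq> \<zeta>"
          using down by auto
        then have "card {..x} \<le> card \<zeta>"
          using fin by (rule card_mono[rotated])
        then show "x \<in> {..<K}"
          using less.prems by simp
      qed
      then have "\<zeta> = {..<K}"
        using less.prems by (intro card_subset_eq) auto
      then show ?thesis
        by simp
    next
      case True
      then obtain y where y: "y \<notin> \<zeta>" "Suc y \<in> \<zeta>"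
        by blast
      define \<zeta>' where "\<zeta>' = exchange (Suc y) y \<zeta>"
      have \<zeta>': "\<zeta>' = insert y (\<zeta> - {Suc y})"
        unfolding \<zeta>'_def using y exchange_eq by metis
      have "\<zeta> = insert (Suc y) (\<zeta>' - {y})"
        using y \<zeta>' by auto
      then have undo: "\<zeta> = exchange y (Suc y) \<zeta>'"
        using exchange_eq[of y \<zeta>' "Suc y"] \<zeta>' by auto
      have sub: "\<zeta>' \<subseteq> {..<N}" and edge: "Suc y < N"
        using y less.prems \<zeta>' by auto
      have "(\<zeta>, \<zeta>') \<in> ?R"
        unfolding \<zeta>'_def using y less.prems edge by (intro jump) (auto simp: path_edge_iff)
      moreover have "(\<zeta>', exchange y (Suc y) \<zeta>') \<in> ?R"
        using sub edge by (intro jump) (auto simp: path_edge_iff \<zeta>')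
      then have "(\<zeta>', \<zeta>) \<in> ?R"
        unfolding undo[symmetric] .
      moreover have "\<Sum>\<zeta>' < \<Sum>\<zeta>"
        using fin y by (simp add: \<zeta>' sum.remove[of \<zeta> "Suc y" "\<lambda>x. x"])
      moreover have "card \<zeta>' = K"
        using less.prems card_exchange[of "Suc y" y \<zeta>] by (simp add: \<zeta>'_def)
      ultimately show ?thesis
        using less.hyps[of \<zeta>'] sub by (meson converse_rtrancl_into_rtrancl rtrancl_into_rtrancl)
    qed
  qed
  show ?thesis
    using packed[OF \<eta>] packed[OF \<xi>] by (meson rtrancl_trans)
qed

section \<open>Weighted sums over configurations\<close>

text \<open>
  This is the elementary symmetric polynomial of degree \<open>k\<close> in the variables \<open>w x\<close> for \<open>x\<in>A\<close>.
\<close>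

definition config_sum :: "('v \<Rightarrow> real) \<Rightarrow> 'v set \<Rightarrow> nat \<Rightarrow> real" where
  "config_sum w A k = (\<Sum>\<eta> | \<eta> \<subseteq> A \<and> card \<eta> = k. \<Prod>x\<in>\<eta>. w x)"

text \<open>
  The vertex \<open>x\<close> contributes its factor, and the other \<open>k\<close> particles are placed freely on the
  remaining vertices.
\<close>

lemma config_sum_occupied:
  assumes A: "finite A" and x: "x \<in> A"
  shows "(\<Sum>\<eta> | \<eta> \<subseteq> A \<and> card \<eta> = Suc k \<and> x \<in> \<eta>. \<Prod>y\<in>\<eta>. w y) = w x * config_sum w (A - {x}) k"
proof -
  have *: "x \<notin> \<eta> \<and> finite \<eta>" if "\<eta> \<subseteq> A - {x}" for \<eta>
    using that A finite_subset by blast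
  have "bij_betw (insert x) {\<eta>. \<eta> \<subseteq> A - {x} \<and> card \<eta> = k} {\<eta>. \<eta> \<subseteq> A \<and> card \<eta> = Suc k \<and> x \<in> \<eta>}"
  proof (rule bij_betw_byWitness[where f' = "\<lambda>\<eta>. \<eta> - {x}"])
    show "(\<lambda>\<eta>. \<eta> - {x}) ` {\<eta>. \<eta> \<subseteq> A \<and> card \<eta> = Suc k \<and> x \<in> \<eta>} \<subseteq> {\<eta>. \<eta> \<subseteq> A - {x} \<and> card \<eta> = k}"
      by auto
  qed (use * x in \<open>auto simp: card_insert_if\<close>)
  then have "(\<Sum>\<eta> | \<eta> \<subseteq> A \<and> card \<eta> = Suc k \<and> x \<in> \<eta>. \<Prod>y\<in>\<eta>. w y) =
      (\<Sum>\<eta> | \<eta> \<subseteq> A - {x} \<and> card \<eta> = k. \<Prod>y\<in>insert x \<eta>. w y)"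
    by (rule sum.reindex_bij_betw[symmetric])
  also have "\<dots> = (\<Sum>\<eta> | \<eta> \<subseteq> A - {x} \<and> card \<eta> = k. w x * (\<Prod>y\<in>\<eta>. w y))"
    using * by (intro sum.cong) auto
  finally show ?thesis
    by (simp add: config_sum_def sum_distrib_left)
qed

lemma config_sum_remove:
  assumes A: "finite A" and x: "x \<in> A"
  shows "config_sum w A (Suc k) = config_sum w (A - {x}) (Suc k) + w x * config_sum w (A - {x}) k"
proof -
  have "{\<eta>. \<eta> \<subseteq> A \<and> card \<eta> = Suc k} =
      {\<eta>. \<eta> \<subseteq> A - {x} \<and> card \<eta> = Suc k} \<union> {\<eta>. \<eta> \<subseteq> A \<and> card \<eta> = Suc k \<and> x \<in> \<eta>}"
    by auto
  then have "config_sum w A (Suc k) =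
      config_sum w (A - {x}) (Suc k) + (\<Sum>\<eta> | \<eta> \<subseteq> A \<and> card \<eta> = Suc k \<and> x \<in> \<eta>. \<Prod>y\<in>\<eta>. w y)"
    unfolding config_sum_def using A by (simp only:) (intro sum.union_disjoint; auto)
  then show ?thesis
    using config_sum_occupied[OF A x] by simp
qed

lemma config_sum_0: "finite A \<Longrightarrow> config_sum w A 0 = 1"
proof -
  assume "finite A"
  then have "{\<eta>. \<eta> \<subseteq> A \<and> card \<eta> = 0} = {{}}"
    by (auto dest: finite_subset)
  then show ?thesis
    by (simp add: config_sum_def)
qed

lemma config_sum_const:
  assumes "finite A" and "\<And>x. x \<in> A \<Longrightarrow> w x = c"
  shows "config_sum w A k = c ^ k * real (card A choose k)"
proof -
  have "config_sum w A k = (\<Sum>\<eta> | \<eta> \<subseteq> A \<and> card \<eta> = k. c ^ k)"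
    unfolding config_sum_def
  proof (intro sum.cong refl)
    fix \<eta> assume \<eta>: "\<eta> \<in> {\<eta>. \<eta> \<subseteq> A \<and> card \<eta> = k}"
    then have "prod w \<eta> = (\<Prod>x\<in>\<eta>. c)"
      using assms(2) by (intro prod.cong) auto
    then show "prod w \<eta> = c ^ k"
      using \<eta> by simp
  qed
  then show ?thesis
    using assms(1) by (simp add: n_subsets)
qed

text \<open>
  The equations \<open>binomial_pred_row\<close> and \<open>binomial_pred\<close> express binomial coefficients of row
  \<open>m\<close> through a single one of row \<open>m + 1\<close>. With subtraction of real numbers both sides vanish
  for all \<open>k > m\<close>, also where the natural difference would be cut off.
\<close>

lemma binomial_pred_row:
  "real (Suc m) * real (m choose k) = (real (Suc m) - real k) * real (Suc m choose k)"
proof (cases "k \<le> m")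
  case True
  then have "k \<le> Suc m" by simp
  have "Suc m * (m choose k) = (Suc m - k) * (Suc m choose k)"
    using binomial_absorb_comp[of "Suc m" k] by simp
  then have "real (Suc m * (m choose k)) = real ((Suc m - k) * (Suc m choose k))"
    by (rule arg_cong)
  then show ?thesis
    using \<open>k \<le> Suc m\<close> by (simp only: of_nat_mult of_nat_diff)
next
  case False
  then show ?thesis
    by (cases "k = Suc m") (auto simp: binomial_eq_0)
qed

lemma binomial_pred:
  "real (Suc m) * real (m choose k) = real (Suc k) * real (Suc m choose Suc k)"
  using Suc_times_binomial_eq[of m k] by (metis of_nat_mult mult.commute)

text \<open>
  A light vertex has weight 1, all others have weight 2. Up to the factor \<open>2 ^ k\<close> this is a sum over uniformly chosen sets of size \<open>k\<close> in which the sets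
  containing \<open>a\<close>, a proportion of \<open>k / card A\<close>, count half. Denominators are multiplied out.
\<close>

lemma config_sum_one_light:
  assumes A: "finite A" and a: "a \<in> A" "w a = 1" and w: "\<And>x. x \<in> A - {a} \<Longrightarrow> w x = 2"
  shows "2 * real (card A) * config_sum w A k =
    2 ^ k * real (card A choose k) * (2 * real (card A) - real k)"
proof (cases k)
  case 0
  then show ?thesis
    using A by (simp add: config_sum_0)
next
  case (Suc l)
  obtain m where m: "card A = Suc m"
    using A a by (metis card_Suc_Diff1)
  have card: "card (A - {a}) = m"
    using A a m by simp
  have "config_sum w A (Suc l) = 2 ^ Suc l * real (m choose Suc l) + 2 ^ l * real (m choose l)"
    using config_sum_remove[OF A a(1), of w l] A w a(2)
      config_sum_const[of "A - {a}" w 2] by (simp add: card)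
  then have "2 * real (Suc m) * config_sum w A (Suc l) =
      2 ^ Suc l * (2 * (real (Suc m) * real (m choose Suc l)) + real (Suc m) * real (m choose l))"
    by (simp add: algebra_simps)
  also have "\<dots> = 2 ^ Suc l * (2 * ((real (Suc m) - real (Suc l)) * real (Suc m choose Suc l)) +
      real (Suc l) * real (Suc m choose Suc l))"
    by (simp only: binomial_pred_row[of m "Suc l"] binomial_pred[of m l])
  also have "\<dots> = 2 ^ Suc l * real (Suc m choose Suc l) * (2 * real (Suc m) - real (Suc l))"
    by algebra
  finally show ?thesis
    by (simp only: Suc m)
qed

text \<open>
  Splitting off \<open>a\<close> leaves sets with the single light vertex \<open>b\<close>.
\<close>

lemma config_sum_two_light:
  assumes A: "finite A" and a: "a \<in> A" "w a = 1" and b: "b \<in> A" "w b = 1" "a \<noteq> b"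
    and w: "\<And>x. x \<in> A - {a, b} \<Longrightarrow> w x = 2"
  shows "4 * real (card A) * (real (card A) - 1) * config_sum w A k =
    2 ^ k * real (card A choose k) *
      (4 * (real (card A) - real k) * (real (card A) - 1) + real k * (real k - 1))"
proof (cases k)
  case 0
  then show ?thesis
    using A by (simp add: config_sum_0)
next
  case (Suc l)
  obtain m where m: "card A = Suc m"
    using A a by (metis card_Suc_Diff1)
  have card: "card (A - {a}) = m"
    using A a m by simp
  have one: "2 * real m * config_sum w (A - {a}) i = 2 ^ i * real (m choose i) * (2 * real m - real i)" for i
    using config_sum_one_light[of "A - {a}" b w i] A b w card by auto
  have "config_sum w A (Suc l) = config_sum w (A - {a}) (Suc l) + config_sum w (A - {a}) l"
    using config_sum_remove[OF A a(1), of w l] a(2) by simp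
  then have "4 * real (Suc m) * real m * config_sum w A (Suc l) =
      2 * real (Suc m) * (2 * real m * config_sum w (A - {a}) (Suc l) + 2 * real m * config_sum w (A - {a}) l)"
    by algebra
  also have "\<dots> = 2 ^ Suc l * (2 * (real (Suc m) * real (m choose Suc l)) * (2 * real m - real (Suc l))
      + real (Suc m) * real (m choose l) * (2 * real m - real l))"
    by (simp only: one power_Suc) algebra
  also have "\<dots> = 2 ^ Suc l * (2 * ((real (Suc m) - real (Suc l)) * real (Suc m choose Suc l)) * (2 * real m - real (Suc l))
      + real (Suc l) * real (Suc m choose Suc l) * (2 * real m - real l))"
    by (simp only: binomial_pred_row[of m "Suc l"] binomial_pred[of m l])
  also have "\<dots> = 2 ^ Suc l * real (Suc m choose Suc l) *
      (4 * (real (Suc m) - real (Suc l)) * real m + real (Suc l) * (real (Suc l) - 1))"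
    by (simp add: algebra_simps)
  finally show ?thesis
    by (simp add: Suc m)
qed

lemma occupation_denominator_pos:
  assumes "2 \<le> N" "0 < K" "K \<le> N"
  shows "0 < (real K - 1) * real K + 4 * (real N - real K) * (real N - 1)"
proof (cases "K = N")
  case False
  then have "0 < (real N - real K) * (real N - 1)" "0 \<le> (real K - 1) * real K"
    using assms by auto
  then show ?thesis
    by linarith
qed (use assms in simp)

text \<open>
  Both sums are multiples of \<open>card A choose K\<close>, so it cancels in the quotient; removing \<open>a\<close>
  leaves the single light vertex \<open>b\<close>.
\<close>

lemma config_sum_ratio_light:
  assumes A: "finite A" and a: "a \<in> A" "w a = 1" and b: "b \<in> A" "w b = 1" "a \<noteq> b"
    and w: "\<And>x. x \<in> A - {a, b} \<Longrightarrow> w x = 2"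
    and N: "card A = N" and K: "0 < K" "K \<le> N"
  shows "w a * config_sum w (A - {a}) (K - 1) / config_sum w A K =
    (2 * real N - real K - 1) * real K / ((real K - 1) * real K + 4 * (real N - real K) * (real N - 1))"
proof -
  have N2: "2 \<le> N"
    using card_mono[of A "{a, b}"] A a b N by simp
  obtain m where m: "N = Suc m" "1 \<le> m"
    using N2 by (cases N) auto
  obtain k where k: "K = Suc k"
    using K by (cases K) auto
  let ?D = "(real K - 1) * real K + 4 * (real N - real K) * (real N - 1)"
  define u where "u = config_sum w A K"
  define v where "v = config_sum w (A - {a}) k"
  have whole: "4 * real N * (real N - 1) * u = 2 ^ K * real (N choose K) * ?D"
    using config_sum_two_light[OF A a b w, of K] by (simp add: u_def N mult_ac add_ac)
  have part: "2 * (real N - 1) * v = 2 ^ k * real (m choose k) * (2 * real N - real K - 1)"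
    using config_sum_one_light[of "A - {a}" b w k] A a b w N
    by (auto simp: v_def m k algebra_simps)
  have row: "real N * real (m choose k) = real K * real (N choose K)"
    using binomial_pred[of m k] by (simp only: m k)
  have D: "0 < ?D"
    using occupation_denominator_pos K N2 by simp
  have "0 < real (N choose K)"
    using K by simp
  then have "0 < 4 * real N * (real N - 1) * u"
    unfolding whole using D by simp
  moreover have "0 < 4 * real N * (real N - 1)"
    using N2 by simp
  ultimately have u: "0 < u"
    by (rule zero_less_mult_pos)
  have "(4 * real N * (real N - 1)) * (v * ?D) = 2 * real N * (2 * (real N - 1) * v) * ?D"
    by algebra
  also have "\<dots> = 2 * (real N * real (m choose k)) * 2 ^ k * (2 * real N - real K - 1) * ?D"
    unfolding part by algebra
  also have "\<dots> = (2 * real N - real K - 1) * real K * (2 ^ K * real (N choose K) * ?D)"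
    unfolding row by (simp add: k)
  also have "\<dots> = (4 * real N * (real N - 1)) * ((2 * real N - real K - 1) * real K * u)"
    unfolding whole[symmetric] by algebra
  finally have "v * ?D = (2 * real N - real K - 1) * real K * u"
    using N2 by simp
  then have "v / u = (2 * real N - real K - 1) * real K / ?D"
    using u D by (simp add: frac_eq_eq)
  then show ?thesis
    by (simp add: u_def v_def k a(2))
qed

text \<open>
  Removing \<open>x\<close> leaves both light vertices, so the numerator has the same shape as the denominator,
  with \<open>N\<close> and \<open>K\<close> lowered by 1.
\<close>

lemma config_sum_ratio_heavy:
  assumes A: "finite A" and a: "a \<in> A" "w a = 1" and b: "b \<in> A" "w b = 1" "a \<noteq> b"
    and w: "\<And>x. x \<in> A - {a, b} \<Longrightarrow> w x = 2"
    and x: "x \<in> A - {a, b}"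
    and N: "card A = N" and K: "0 < K" "K \<le> N"
  shows "w x * config_sum w (A - {x}) (K - 1) / config_sum w A K =
    real K / (real N - 2) *
      (((real K - 2) * (real K - 1) + 4 * (real N - real K) * (real N - 2)) /
       ((real K - 1) * real K + 4 * (real N - real K) * (real N - 1)))"
proof -
  have N3: "3 \<le> N"
    using card_mono[of A "{a, b, x}"] A a b x N by auto
  obtain m where m: "N = Suc m"
    using N3 by (cases N) auto
  obtain k where k: "K = Suc k"
    using K by (cases K) auto
  let ?D = "(real K - 1) * real K + 4 * (real N - real K) * (real N - 1)"
  let ?D' = "(real K - 2) * (real K - 1) + 4 * (real N - real K) * (real N - 2)"
  define u where "u = config_sum w A K"
  define v where "v = config_sum w (A - {x}) k"
  have whole: "4 * real N * (real N - 1) * u = 2 ^ K * real (N choose K) * ?D"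
    using config_sum_two_light[OF A a b w, of K] by (simp add: u_def N mult_ac add_ac)
  have card: "card (A - {x}) = m"
    using A x N m by simp
  have "4 * real m * (real m - 1) * v =
      2 ^ k * real (m choose k) * (4 * (real m - real k) * (real m - 1) + real k * (real k - 1))"
    using config_sum_two_light[of "A - {x}" a w b k] A a b w x unfolding card v_def by auto
  then have part: "4 * (real N - 1) * (real N - 2) * v = 2 ^ k * real (m choose k) * ?D'"
    by (simp add: m k algebra_simps)
  have row: "real N * real (m choose k) = real K * real (N choose K)"
    using binomial_pred[of m k] by (simp only: m k)
  have D: "0 < ?D"
    using occupation_denominator_pos K N3 by simp
  have "0 < real (N choose K)"
    using K by simp
  then have "0 < 4 * real N * (real N - 1) * u"
    unfolding whole using D by simp
  moreover have "0 < 4 * real N * (real N - 1)"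
    using N3 by simp
  ultimately have u: "0 < u"
    by (rule zero_less_mult_pos)
  have "(4 * real N * (real N - 1)) * (2 * v * ((real N - 2) * ?D)) =
      2 * real N * (4 * (real N - 1) * (real N - 2) * v) * ?D"
    by algebra
  also have "\<dots> = 2 * (real N * real (m choose k)) * 2 ^ k * ?D' * ?D"
    unfolding part by algebra
  also have "\<dots> = real K * ?D' * (2 ^ K * real (N choose K) * ?D)"
    unfolding row by (simp add: k)
  also have "\<dots> = (4 * real N * (real N - 1)) * (real K * ?D' * u)"
    unfolding whole[symmetric] by algebra
  finally have "2 * v * ((real N - 2) * ?D) = real K * ?D' * u"
    by (rule mult_left_cancel[THEN iffD1, rotated]) (use N3 in simp)
  then have "2 * v / u = real K * ?D' / ((real N - 2) * ?D)"
    using u D N3 by (subst frac_eq_eq) auto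
  then show ?thesis
    using w[OF x] by (simp add: u_def v_def k)
qed

section \<open>Limiting occupation probabilities on the path\<close>

text \<open>
  The weight of the degrees, cut off to configurations of size \<open>K\<close>, is still in detailed balance
  since jumps preserve the size; the convergence theorem applies to it on the class of these
  configurations.
\<close>

lemma path_exclusion_limit:
  assumes N: "2 \<le> N" and K: "0 < K"
    and sep: "simple_exclusion_process M (path_vertices N) (path_edges N) (\<lambda>x. 1) \<eta>"
    and pos: "0 < \<P>(\<omega> in M. card (\<eta> 0 \<omega>) = K)"
    and x: "x < N"
    and w: "\<And>y. w y = real (deg (path_edges N) y)"
  shows "has_limit_occupation M \<eta> K x
    (w x * config_sum w ({..<N} - {x}) (K - 1) / config_sum w {..<N} K)"
proof -
  let ?E = "path_edges N"
  define S where "S = Pow {..<N}"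
  define C where "C = {\<zeta>. \<zeta> \<subseteq> {..<N} \<and> card \<zeta> = K}"
  define \<pi> where "\<pi> \<zeta> = (if card \<zeta> = K then deg_weight ?E \<zeta> else 0)" for \<zeta>
  have chain: "markov_chain_with_rates M S (exclusion_rate ?E (\<lambda>_. 1)) \<eta>"
    using sep by (simp add: simple_exclusion_process_def path_vertices_def S_def)
  then have in_S: "\<eta> 0 \<omega> \<in> S" if "\<omega> \<in> space M" for \<omega>
    using that measurable_space[of "\<eta> 0" M "count_space S"]
    by (simp add: markov_chain_with_rates_def)
  then have in_C: "\<omega> \<in> space M \<and> Q \<and> \<eta> 0 \<omega> \<in> C \<longleftrightarrow> \<omega> \<in> space M \<and> Q \<and> card (\<eta> 0 \<omega>) = K" for \<omega> Q
    by (auto simp: C_def S_def)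
  have "finite (\<Union>?E)"
    by (rule finite_subset[of _ "{..<N}"]) (auto simp: path_edges_def)
  then have detailed: "\<pi> \<zeta> * exclusion_rate ?E (\<lambda>_. 1) \<zeta> \<xi> = \<pi> \<xi> * exclusion_rate ?E (\<lambda>_. 1) \<xi> \<zeta>"
    if "\<zeta> \<in> S" "\<xi> \<in> S" for \<zeta> \<xi>
  proof (cases "card \<zeta> = card \<xi>")
    case True
    have "finite \<zeta>" "finite \<xi>"
      using that finite_subset by (auto simp: S_def)
    then show ?thesis
      using True exclusion_detailed_balance[OF \<open>finite (\<Union>?E)\<close>, of \<zeta> \<xi>] by (simp add: \<pi>_def)
  qed (simp add: exclusion_rate_card_neq)
  have "((\<lambda>t. P t \<zeta> \<xi>) \<longlongrightarrow> \<pi> \<xi> / (\<Sum>\<zeta>\<in>C. \<pi> \<zeta>)) at_top"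
    if "transition_function S P" "has_jump_rates S (exclusion_rate ?E (\<lambda>_. 1)) P" "\<zeta> \<in> C" "\<xi> \<in> S"
    for P \<zeta> \<xi>
  proof (rule transition_tendsto_stationary[OF _ that(1,2) _ _ _ _ _ that(3,4)])
    show "finite S" "C \<subseteq> S"
      by (auto simp: S_def C_def)
    show "0 < \<pi> \<zeta>" if "\<zeta> \<in> C" for \<zeta>
      using that deg_path[OF N] by (auto simp: \<pi>_def C_def deg_weight_def intro!: prod_pos)
    show "\<pi> \<zeta> = 0" if "\<zeta> \<in> S - C" for \<zeta>
      using that by (auto simp: \<pi>_def S_def C_def)
    show "(\<Sum>\<zeta>\<in>S - {\<xi>}. \<pi> \<zeta> * exclusion_rate ?E (\<lambda>_. 1) \<zeta> \<xi>) =
        \<pi> \<xi> * (\<Sum>\<zeta>\<in>S - {\<xi>}. exclusion_rate ?E (\<lambda>_. 1) \<xi> \<zeta>)" if "\<xi> \<in> S" for \<xi>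
      unfolding sum_distrib_left using that by (intro sum.cong refl detailed) auto
    show "(\<zeta>, \<xi>) \<in> {(a, b). a \<in> S \<and> b \<in> S \<and> 0 < exclusion_rate ?E (\<lambda>_. 1) a b}\<^sup>*"
      if "\<zeta> \<in> C" "\<xi> \<in> C" for \<zeta> \<xi>
      using path_exclusion_irreducible[OF N] that by (auto simp: C_def S_def)
  qed
  moreover have "0 < \<P>(\<omega> in M. \<eta> 0 \<omega> \<in> C)"
    using pos in_C[of _ True] by simp
  ultimately have "((\<lambda>t. \<P>(\<omega> in M. \<eta> t \<omega> \<in> {\<zeta>. x \<in> \<zeta>} \<bar> \<eta> 0 \<omega> \<in> C)) \<longlongrightarrow>
      (\<Sum>\<xi>\<in>{\<zeta>. x \<in> \<zeta>} \<inter> S. \<pi> \<xi> / (\<Sum>\<zeta>\<in>C. \<pi> \<zeta>))) at_top"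
    using markov_chain_conditional_limit[OF chain, of C "\<lambda>\<xi>. \<pi> \<xi> / (\<Sum>\<zeta>\<in>C. \<pi> \<zeta>)" "{\<zeta>. x \<in> \<zeta>}"]
    by (auto simp: C_def S_def)
  moreover have "\<P>(\<omega> in M. \<eta> t \<omega> \<in> {\<zeta>. x \<in> \<zeta>} \<bar> \<eta> 0 \<omega> \<in> C) =
      \<P>(\<omega> in M. x \<in> \<eta> t \<omega> \<bar> card (\<eta> 0 \<omega>) = K)" for t
    using in_C[of _ True] by (simp add: cond_prob_def in_C)
  moreover have "(\<Sum>\<zeta>\<in>C. \<pi> \<zeta>) = config_sum w {..<N} K"
    by (simp add: config_sum_def C_def \<pi>_def deg_weight_def w)
  moreover have "(\<Sum>\<xi>\<in>{\<zeta>. x \<in> \<zeta>} \<inter> S. \<pi> \<xi>) = w x * config_sum w ({..<N} - {x}) (K - 1)"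
  proof -
    have "(\<Sum>\<xi>\<in>{\<zeta>. x \<in> \<zeta>} \<inter> S. \<pi> \<xi>) =
        (\<Sum>\<xi> | \<xi> \<subseteq> {..<N} \<and> card \<xi> = Suc (K - 1) \<and> x \<in> \<xi>. \<pi> \<xi>)"
      using K by (intro sum.mono_neutral_right) (auto simp: S_def \<pi>_def)
    also have "\<dots> = (\<Sum>\<xi> | \<xi> \<subseteq> {..<N} \<and> card \<xi> = Suc (K - 1) \<and> x \<in> \<xi>. \<Prod>y\<in>\<xi>. w y)"
      using K by (intro sum.cong) (auto simp: \<pi>_def deg_weight_def w)
    also have "\<dots> = w x * config_sum w ({..<N} - {x}) (K - 1)"
      using x by (intro config_sum_occupied) auto
    finally show ?thesis .
  qed
  ultimately show ?thesis
    by (simp add: has_limit_occupation_def flip: sum_divide_distrib)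
qed

theorem theorem4:
  fixes N K :: nat
    and M :: "'w measure"
    and \<eta> :: "real \<Rightarrow> 'w \<Rightarrow> nat set"
  assumes "2 \<le> N" and "0 < K" and "K \<le> N"
    and "simple_exclusion_process M (path_vertices N) (path_edges N) (\<lambda>x. 1) \<eta>"
    and "0 < \<P>(\<omega> in M. card (\<eta> 0 \<omega>) = K)"
  shows "(\<forall>x \<in> {0, N - 1}. has_limit_occupation M \<eta> K x
            ((2 * real N - real K - 1) * real K /
             ((real K - 1) * real K + 4 * (real N - real K) * (real N - 1)))) \<and>
         (\<forall>x. 0 < x \<and> x < N - 1 \<longrightarrow> has_limit_occupation M \<eta> K x
            (real K / (real N - 2) *
             (((real K - 2) * (real K - 1) + 4 * (real N - real K) * (real N - 2)) /
              ((real K - 1) * real K + 4 * (real N - real K) * (real N - 1)))))"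
proof -
  define w where "w y = real (deg (path_edges N) y)" for y
  have ends: "0 \<in> {..<N}" "w 0 = 1" "N - 1 \<in> {..<N}" "w (N - 1) = 1" "0 \<noteq> N - 1" "N - 1 \<noteq> 0"
    using assms(1) deg_path[OF assms(1)] by (auto simp: w_def)
  have inner: "w y = 2" if "y \<in> {..<N} - {0, N - 1}" for y
    using that deg_path[OF assms(1)] by (auto simp: w_def)
  then have inner': "w y = 2" if "y \<in> {..<N} - {N - 1, 0}" for y
    using that by blast
  note limit = path_exclusion_limit[OF assms(1,2,4,5) _ w_def]
  note K = card_lessThan assms(2,3)
  show ?thesis
  proof (intro conjI ballI allI impI)
    fix x assume "x \<in> {0, N - 1}"
    then show "has_limit_occupation M \<eta> K x ((2 * real N - real K - 1) * real K /
             ((real K - 1) * real K + 4 * (real N - real K) * (real N - 1)))"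
      using limit[of x] ends
        config_sum_ratio_light[where w = w, OF finite_lessThan ends(1,2,3,4,5) inner K]
        config_sum_ratio_light[where w = w, OF finite_lessThan ends(3,4,1,2,6) inner' K]
      by fastforce
  next
    fix x assume "0 < x \<and> x < N - 1"
    then have x: "x \<in> {..<N} - {0, N - 1}" "x < N"
      by auto
    show "has_limit_occupation M \<eta> K x
            (real K / (real N - 2) *
             (((real K - 2) * (real K - 1) + 4 * (real N - real K) * (real N - 2)) /
              ((real K - 1) * real K + 4 * (real N - real K) * (real N - 1))))"
      using limit[OF x(2)]
      by (simp only: config_sum_ratio_heavy[where w = w, OF finite_lessThan ends(1,2,3,4,5) inner x(1) K])
  qed
qed

end
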